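(* Let $\mathbf{w}\in\mathbb{Z}_2^n$ have Hamming weight smaller than $n/2$, and suppose the cyclic game $C(\mathbf{w})$ is proper. Then $C(\mathbf{w})$ is not roughly weighted.
   Context: A simple game is $(P,W)$ with $P=[n]$, $W\subseteq 2^P$ (winning coalitions) closed under supersets within $P$, $W\ne\emptyset$, $W\ne 2^P$; other coalitions are losing; it is determined by its minimal winning coalitions. The cyclic game $C(\mathbf{w})$ is the simple game on $[n]$ whose minimal winning coalitions are exactly those whose characteristic vectors are $\mathbf{w}$ and all its cyclic permutations (cyclic shifts of coordinates). A game is proper if $X\in W$ implies $P\setminus X\notin W$. A game is roughly weighted if there exist non-negative reals $w_1,\dots,w_n$ and a real $q$, not all zero, such that $\sum_{i\in X}w_i<q$ implies $X$ is losing and $\sum_{i\in X}w_i>q$ implies $X$ is winning. *)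

theory Defs
  imports Complex_Main "HOL-Library.Z2"
begin

definition simple_game :: "'a set \<Rightarrow> 'a set set \<Rightarrow> bool" where
  "simple_game P W \<longleftrightarrow>
     W \<subseteq> Pow P \<and> (\<forall>X Y. X \<in> W \<longrightarrow> X \<subseteq> Y \<longrightarrow> Y \<subseteq> P \<longrightarrow> Y \<in> W) \<and> W \<noteq> {} \<and> W \<noteq> Pow P"

definition minimal_winning :: "'a set set \<Rightarrow> 'a set set" where
  "minimal_winning W = {X \<in> W. \<forall>Y. Y \<subset> X \<longrightarrow> Y \<notin> W}"

definition proper_game :: "'a set \<Rightarrow> 'a set set \<Rightarrow> bool" where
  "proper_game P W \<longleftrightarrow> (\<forall>X. X \<in> W \<longrightarrow> P - X \<notin> W)"

(* The threshold q is among the reals that must not all vanish. *)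
definition roughly_weighted :: "'a set \<Rightarrow> 'a set set \<Rightarrow> bool" where
  "roughly_weighted P W \<longleftrightarrow>
     (\<exists>(u :: 'a \<Rightarrow> real) (q :: real).
        (\<forall>i\<in>P. 0 \<le> u i) \<and> \<not> (q = 0 \<and> (\<forall>i\<in>P. u i = 0)) \<and>
        (\<forall>X. X \<subseteq> P \<longrightarrow> ((\<Sum>i\<in>X. u i) < q \<longrightarrow> X \<notin> W) \<and> ((\<Sum>i\<in>X. u i) > q \<longrightarrow> X \<in> W)))"

(* Vectors over the two-element field are lists; coordinate i, for i in {1..n}, is at list position i - 1. *)

definition hamming_weight :: "bit list \<Rightarrow> nat" where
  "hamming_weight w = length (filter (\<lambda>b. b \<noteq> 0) w)"

definition char_vec :: "nat \<Rightarrow> nat set \<Rightarrow> bit list" where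
  "char_vec n X = map (\<lambda>i. if i \<in> X then 1 else 0) [1..<n + 1]"

definition cyclic_game :: "nat \<Rightarrow> bit list \<Rightarrow> nat set set \<Rightarrow> bool" where
  "cyclic_game n w W \<longleftrightarrow>
     simple_game {1..n} W \<and>
     minimal_winning W = {X. X \<subseteq> {1..n} \<and> (\<exists>k. char_vec n X = rotate k w)}"

lemma hamming_weight_rotate: "hamming_weight (rotate k w) = hamming_weight w"
proof (induction k)
  case (Suc k)
  have "hamming_weight (rotate1 v) = hamming_weight v" for v
    by (cases v) (auto simp: hamming_weight_def)
  with Suc show ?case by simp
qed simp

lemma hamming_weight_char_vec:
  assumes "X \<subseteq> {1..n}"
  shows "hamming_weight (char_vec n X) = card X"
proof -
  have "hamming_weight (char_vec n X) = length (filter (\<lambda>i. i \<in> X) [1..<n + 1])"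
  proof -
    have "(\<lambda>b :: bit. b \<noteq> 0) \<circ> (\<lambda>i. if i \<in> X then 1 else 0) = (\<lambda>i. i \<in> X)"
      by (auto simp: fun_eq_iff)
    then show ?thesis
      by (simp only: hamming_weight_def char_vec_def filter_map length_map)
  qed
  also have "\<dots> = card ({1..<n + 1} \<inter> X)"
  proof -
    have "length (filter (\<lambda>i. i \<in> X) [1..<n + 1]) = card (set (filter (\<lambda>i. i \<in> X) [1..<n + 1]))"
      by (rule distinct_card [symmetric]) (simp del: upt_Suc)
    also have "set (filter (\<lambda>i. i \<in> X) [1..<n + 1]) = {1..<n + 1} \<inter> X"
      by (auto simp del: upt_Suc)
    finally show ?thesis .
  qed
  also have "{1..<n + 1} \<inter> X = X" using assms by auto
  finally show ?thesis .
qed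

lemma ex_char_vec:
  assumes "length w = n"
  obtains X where "X \<subseteq> {1..n}" "char_vec n X = w"
proof
  show "{i \<in> {1..n}. w ! (i - 1) = 1} \<subseteq> {1..n}" by auto
  show "char_vec n {i \<in> {1..n}. w ! (i - 1) = 1} = w"
    using assms by (intro nth_equalityI) (auto simp: char_vec_def simp del: upt_Suc)
qed

lemma winning_iff_minimal_winning:
  assumes "finite P" "simple_game P W"
  shows "X \<in> W \<longleftrightarrow> X \<subseteq> P \<and> (\<exists>Y\<in>minimal_winning W. Y \<subseteq> X)"
proof
  assume X: "X \<in> W"
  have sub: "W \<subseteq> Pow P" using assms(2) by (simp add: simple_game_def)
  then have "finite W" using assms(1) finite_subset by blast
  then have "\<exists>Y\<in>W. Y \<subseteq> X \<and> (\<forall>Z\<in>W. Z \<subseteq> Y \<longrightarrow> Y = Z)"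
    by (rule finite_has_minimal2 [OF _ X])
  then obtain Y where Y: "Y \<in> W" "Y \<subseteq> X" "\<forall>Z\<in>W. Z \<subseteq> Y \<longrightarrow> Y = Z"
    by (elim bexE conjE)
  have "Y \<in> minimal_winning W"
    using Y(1,3) by (auto simp: minimal_winning_def)
  with X Y(2) sub show "X \<subseteq> P \<and> (\<exists>Y\<in>minimal_winning W. Y \<subseteq> X)"
    by auto
next
  assume "X \<subseteq> P \<and> (\<exists>Y\<in>minimal_winning W. Y \<subseteq> X)"
  then obtain Y where "Y \<in> W" "Y \<subseteq> X" "X \<subseteq> P" by (auto simp: minimal_winning_def)
  moreover have "\<forall>X Y. X \<in> W \<longrightarrow> X \<subseteq> Y \<longrightarrow> Y \<subseteq> P \<longrightarrow> Y \<in> W"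
    using assms(2) unfolding simple_game_def by (elim conjE)
  ultimately show "X \<in> W" by metis
qed

(* A nonzero vector determines exactly one cyclic game; the zero vector would make the empty
   coalition winning, so it determines none. *)
lemma ex1_cyclic_game:
  assumes "length w = n" "hamming_weight w \<noteq> 0"
  shows "\<exists>!W. cyclic_game n w W"
proof -
  define S where "S = {X. X \<subseteq> {1..n} \<and> (\<exists>k. char_vec n X = rotate k w)}"
  define W where "W = {X. X \<subseteq> {1..n} \<and> (\<exists>Y\<in>S. Y \<subseteq> X)}"
  have card: "card X = hamming_weight w" if "X \<in> S" for X
  proof -
    from that obtain k where "X \<subseteq> {1..n}" "char_vec n X = rotate k w"
      unfolding S_def by blast
    then show ?thesis
      using hamming_weight_char_vec [of X n] by (simp add: hamming_weight_rotate)
  qed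
  have fin: "finite X" if "X \<in> S" for X
    using that finite_subset unfolding S_def by blast
  have S_W: "S \<subseteq> W" unfolding W_def S_def by auto
  obtain X where "X \<subseteq> {1..n}" "char_vec n X = w" using ex_char_vec assms(1) by blast
  then have "X \<in> S" unfolding S_def by (auto intro: exI [of _ 0])
  have "{} \<notin> S" using card [of "{}"] assms(2) by auto
  then have "{} \<notin> W" unfolding W_def by auto
  then have "W \<noteq> Pow {1..n}" by blast
  moreover have "W \<noteq> {}" using \<open>X \<in> S\<close> S_W by blast
  moreover have "W \<subseteq> Pow {1..n}" "\<forall>X Y. X \<in> W \<longrightarrow> X \<subseteq> Y \<longrightarrow> Y \<subseteq> {1..n} \<longrightarrow> Y \<in> W"
    unfolding W_def by blast+
  ultimately have sg: "simple_game {1..n} W"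
    unfolding simple_game_def by blast
  have min: "minimal_winning W = S"
  proof
    show "minimal_winning W \<subseteq> S"
      using S_W unfolding minimal_winning_def W_def by blast
    have "Y \<notin> W" if "X \<in> S" "Y \<subset> X" for X Y
    proof
      assume "Y \<in> W"
      then obtain Z where "Z \<in> S" "Z \<subseteq> Y" unfolding W_def by blast
      with that have "card Z < card X" by (intro psubset_card_mono fin) auto
      with card that \<open>Z \<in> S\<close> show False by simp
    qed
    with S_W show "S \<subseteq> minimal_winning W" unfolding minimal_winning_def by blast
  qed
  show ?thesis
  proof (rule ex1I)
    show "cyclic_game n w W" using sg min unfolding cyclic_game_def S_def by simp
    fix V assume "cyclic_game n w V"
    then have "simple_game {1..n} V" "minimal_winning V = S"
      unfolding cyclic_game_def S_def by auto
    then show "V = W" using winning_iff_minimal_winning [of "{1..n}" V]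
      unfolding W_def by auto
  qed
qed

end

theory Submission
  imports Defs
begin

text \<open>
  Average the weights over the n cyclic shifts of a minimal winning coalition. Each shift X wins, so
  u(X) \<ge> q, and by properness its complement loses, so u(P - X) \<le> q. Writing h for the Hamming
  weight and U for the total weight, each player lies in exactly h of the shifts, whence
  (n - h) U \<le> n q \<le> h U. Since 2 h < n, this forces U = 0 and q = 0.
\<close>

text \<open>Indexing by the shift amount \<open>k\<close> lets a periodic \<open>w\<close> yield the
  same coalition for several \<open>k\<close>. Counting with this multiplicity keeps the incidence
  numbers uniform without a case split on the period.\<close>

definition shift_coalition :: "bit list \<Rightarrow> nat \<Rightarrow> nat set" where
  "shift_coalition w k = {i \<in> {1..length w}. rotate k w ! (i - 1) \<noteq> 0}"

lemma char_vec_shift_coalition: "char_vec (length w) (shift_coalition w k) = rotate k w"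
  by (intro nth_equalityI) (auto simp: char_vec_def shift_coalition_def simp del: upt_Suc)

text \<open>The entry of \<open>rotate k w\<close> at position \<open>i - 1\<close> is
  \<open>w ! ((k + (i - 1)) mod length w)\<close>, which is symmetric in \<open>k\<close> and
  \<open>i - 1\<close>. With \<open>i\<close> fixed and \<open>k\<close> varying, these entries
  therefore form a rotation of \<open>w\<close> again.\<close>

lemma card_shifts_containing:
  assumes "i \<in> {1..length w}"
  shows "card {k \<in> {..<length w}. i \<in> shift_coalition w k} = hamming_weight w"
proof -
  have "rotate k w ! (i - 1) = rotate (i - 1) w ! k" if "k < length w" for k
    using that assms by (auto simp: nth_rotate add.commute)
  then have "{k \<in> {..<length w}. i \<in> shift_coalition w k}
      = {k. k < length (rotate (i - 1) w) \<and> rotate (i - 1) w ! k \<noteq> 0}"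
    using assms unfolding shift_coalition_def by auto
  then have "card {k \<in> {..<length w}. i \<in> shift_coalition w k} = hamming_weight (rotate (i - 1) w)"
    unfolding hamming_weight_def by (simp only: length_filter_conv_card)
  then show ?thesis by (simp only: hamming_weight_rotate)
qed

text \<open>Double counting of the pairs of a shift and a player in it.\<close>

lemma sum_shift_coalitions:
  fixes u :: "nat \<Rightarrow> real"
  shows "(\<Sum>k<length w. sum u (shift_coalition w k)) = hamming_weight w * sum u {1..length w}"
proof -
  have "(\<Sum>k<length w. sum u (shift_coalition w k))
      = (\<Sum>k<length w. \<Sum>i\<in>{1..length w}. if i \<in> shift_coalition w k then u i else 0)"
  proof (rule sum.cong [OF refl])
    fix k
    have "{i \<in> {1..length w}. i \<in> shift_coalition w k} = shift_coalition w k"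
      by (auto simp: shift_coalition_def)
    then show "sum u (shift_coalition w k)
        = (\<Sum>i\<in>{1..length w}. if i \<in> shift_coalition w k then u i else 0)"
      using sum.inter_filter [of "{1..length w}" u "\<lambda>i. i \<in> shift_coalition w k"] by simp
  qed
  also have "\<dots> = (\<Sum>i\<in>{1..length w}. \<Sum>k<length w. if i \<in> shift_coalition w k then u i else 0)"
    by (rule sum.swap)
  also have "\<dots> = (\<Sum>i\<in>{1..length w}. hamming_weight w * u i)"
    by (intro sum.cong refl, subst sum.inter_filter [symmetric])
      (simp_all only: finite_lessThan sum_constant card_shifts_containing)
  finally show ?thesis by (simp only: sum_distrib_left)
qed

theorem theorem8:
  fixes n :: nat and w :: "bit list" and W :: "nat set set"
  assumes "length w = n"
    and "real (hamming_weight w) < real n / 2"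
    and "cyclic_game n w W"
    and "proper_game {1..n} W"
  shows "\<not> roughly_weighted {1..n} W"
proof
  assume "roughly_weighted {1..n} W"
  then obtain u :: "nat \<Rightarrow> real" and q where
    nonneg: "\<forall>i\<in>{1..n}. 0 \<le> u i" and
    nontriv: "\<not> (q = 0 \<and> (\<forall>i\<in>{1..n}. u i = 0))" and
    lose: "\<And>X. X \<subseteq> {1..n} \<Longrightarrow> sum u X < q \<Longrightarrow> X \<notin> W" and
    win: "\<And>X. X \<subseteq> {1..n} \<Longrightarrow> sum u X > q \<Longrightarrow> X \<in> W"
    unfolding roughly_weighted_def by blast
  define U where "U = sum u {1..n}"
  let ?h = "hamming_weight w" and ?X = "shift_coalition w"
  have sub: "?X k \<subseteq> {1..n}" for k
    using assms(1) unfolding shift_coalition_def by auto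
  have "?X k \<in> minimal_winning W" for k
    using assms(1,3) sub char_vec_shift_coalition unfolding cyclic_game_def by blast
  then have X_win: "?X k \<in> W" for k
    unfolding minimal_winning_def by blast
  then have "{1..n} - ?X k \<notin> W" for k
    using assms(4) unfolding proper_game_def by blast
  \<comment> \<open>By contraposition of \<open>win\<close>. A coalition of weight exactly
    \<open>q\<close> may win or lose, so only weak inequalities are available here and in
    \<open>lower\<close>.\<close>
  then have "sum u ({1..n} - ?X k) \<le> q" for k
    using win Diff_subset by (meson not_less)
  then have upper: "U - sum u (?X k) \<le> q" for k
    unfolding U_def sum_diff [OF finite_atLeastAtMost sub, symmetric] .
  have lower: "q \<le> sum u (?X k)" for k
    using lose sub X_win by (meson not_less)
  have avg: "(\<Sum>k<n. sum u (?X k)) = ?h * U"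
    using sum_shift_coalitions [of u w] assms(1) unfolding U_def by simp
  have q_le: "n * q \<le> ?h * U"
    using sum_mono [of "{..<n}" "\<lambda>_. q" "\<lambda>k. sum u (?X k)"] lower avg by simp
  have le_q: "n * U - ?h * U \<le> n * q"
    using sum_mono [of "{..<n}" "\<lambda>k. U - sum u (?X k)" "\<lambda>_. q"] upper avg
    by (simp add: sum_subtractf)
  have "(real n - 2 * ?h) * U \<le> 0"
    using q_le le_q by (simp add: algebra_simps)
  \<comment> \<open>The strict bound on the Hamming weight makes the factor
    \<open>real n - 2 * ?h\<close> positive.\<close>
  then have "U \<le> 0"
    using assms(2) by (simp add: mult_le_0_iff)
  moreover have "U \<ge> 0" unfolding U_def using nonneg by (intro sum_nonneg) blast
  ultimately have "U = 0" by simp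
  with q_le le_q have "real n * q = 0" by simp
  \<comment> \<open>The weight bound also forces \<open>n > 0\<close>, since \<open>?h\<close> is at
    least 0, so \<open>n\<close> can be cancelled.\<close>
  then have "q = 0" using assms(2) by auto
  moreover have "\<forall>i\<in>{1..n}. u i = 0"
    using \<open>U = 0\<close> nonneg unfolding U_def by (subst (asm) sum_nonneg_eq_0_iff) auto
  ultimately show False using nontriv by blast
qed

end
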